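(* Let $\mathbb X$ be a Banach space over $\mathbb K=\mathbb R$ or $\mathbb C$ and let $\{\mathbf e_n,\mathbf e_n^*\}_{n=1}^\infty$ be a semi-normalized biorthogonal system in $\mathbb X\times\mathbb X^*$ whose vectors $\mathbf e_n$ have dense span (as in the context). If $k_N^c=1$ for some $N\ge 1$, then for that $N$ $$\mathbf L_N=\widetilde{\mathbf L}_N=\nu_N .$$
   Context: Setting: $\mathbb X$ is a Banach space over $\mathbb K=\mathbb R$ or $\mathbb C$; $\{\mathbf e_n,\mathbf e_n^*\}_{n=1}^\infty\subset\mathbb X\times\mathbb X^*$ satisfies $\mathbf e_m^*(\mathbf e_n)=\delta_{m,n}$; $\mathscr B=\{\mathbf e_n\}$ has dense linear span in $\mathbb X$; and $0<\kappa_1\le\|\mathbf e_n\|,\|\mathbf e_n^*\|\le\kappa_2<\infty$ for all $n$. (Then $\lim_n\mathbf e_n^*(x)=0$ for all $x\in\mathbb X$.) Projections: for finite $A\subset\mathbb N$, $P_Ax=\sum_{n\in A}\mathbf e_n^*(x)\mathbf e_n$; $k_N^c=\sup_{|A|\le N}\|I-P_A\|$. Greedy sets: a finite set $\Gamma\subset\mathbb N$ is a greedy set for $x$ if $\min_{n\in\Gamma}|\mathbf e_n^*(x)|\ge\max_{n\in\Gamma^c}|\mathbf e_n^*(x)|$; $\mathscr G(x,N)$ is the collection of greedy sets for $x$ of cardinality $N$. $\mathscr G_N$ is the set of all maps $G:\mathbb X\to\mathbb X$ with $Gx=P_{\Gamma_x}x$ for some choice $\Gamma_x\in\mathscr G(x,N)$,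 for each $x$. Approximation errors: $\Sigma_N=\{\sum_{n\in A}a_n\mathbf e_n: |A|\le N,\ a_n\in\mathbb K\}$, $\sigma_N(x)=\operatorname{dist}(x,\Sigma_N)$, $\widetilde\sigma_N(x)=\inf\{\|x-P_Ax\|: |A|\le N\}$. Lebesgue constants: $\mathbf L_N$ (resp. $\widetilde{\mathbf L}_N$) is the smallest number such that $\|x-Gx\|\le\mathbf L_N\sigma_N(x)$ (resp. $\|x-Gx\|\le\widetilde{\mathbf L}_N\widetilde\sigma_N(x)$) for all $x\in\mathbb X$ and all $G\in\mathscr G_N$. $\Upsilon$ is the set of sequences $\boldsymbol\varepsilon=\{\varepsilon_n\}$ in $\mathbb K$ with $|\varepsilon_n|=1$ for all $n$; $\mathbf 1_{\boldsymbol\varepsilon A}=\sum_{n\in A}\varepsilon_n\mathbf e_n$. $\nu_N$ is the supremum of $\|\mathbf 1_{\boldsymbol\varepsilon A}+x\|/\|\mathbf 1_{\boldsymbol\eta B}+x\|$ over all $|A|=|B|\le N$ (nonempty), $\boldsymbol\varepsilon,\boldsymbol\eta\in\Upsilon$, and $x\in\mathbb X$ with $|x|_\infty:=\sup_n|\mathbf e_n^*(x)|\le1$ such that $A$, $B$ and $\operatorname{supp}x=\{n:\mathbf e_n^*(x)\ne0\}$ are pairwise disjoint. *)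

theory Defs
  imports "HOL-Analysis.Analysis"
begin

text \<open>
  The library's normed spaces are real. A Banach space over a scalar field \<open>'k\<close> is a type of class
  \<open>banach\<close> with an additional scalar multiplication \<open>sc\<close> over \<open>'k\<close> that extends the real one and
  for which the given norm is homogeneous. It is used for \<open>'k = real\<close> and \<open>'k = complex\<close>.
\<close>

locale banach_space_over = vector_space sc
  for sc :: "'k::real_normed_field \<Rightarrow> 'a::banach \<Rightarrow> 'a" +
  assumes sc_of_real: "sc (of_real r) x = r *\<^sub>R x"
    and norm_sc: "norm (sc c x) = norm c * norm x"

text \<open>
  Sequences are indexed from \<open>0\<close>. For a bounded functional, \<^const>\<open>onorm\<close> is its norm in the dual.
\<close>

locale seminormalized_biorthogonal_system = banach_space_over sc
  for sc :: "'k::real_normed_field \<Rightarrow> 'a::banach \<Rightarrow> 'a" +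
  fixes e :: "nat \<Rightarrow> 'a" and f :: "nat \<Rightarrow> 'a \<Rightarrow> 'k"
  assumes linear_f: "Vector_Spaces.linear sc (*) (f n)"
    and bounded_linear_f: "bounded_linear (f n)"
    and biorthogonal: "f m (e n) = (if m = n then 1 else 0)"
    and dense_span: "closure (module.span sc (range e)) = UNIV"
    and seminormalized: "\<exists>\<kappa>\<^sub>1 \<kappa>\<^sub>2. 0 < \<kappa>\<^sub>1 \<and>
      (\<forall>n. \<kappa>\<^sub>1 \<le> norm (e n) \<and> norm (e n) \<le> \<kappa>\<^sub>2 \<and> \<kappa>\<^sub>1 \<le> onorm (f n) \<and> onorm (f n) \<le> \<kappa>\<^sub>2)"

definition coord_proj ::
  "('k::real_normed_field \<Rightarrow> 'a::banach \<Rightarrow> 'a) \<Rightarrow> (nat \<Rightarrow> 'a) \<Rightarrow> (nat \<Rightarrow> 'a \<Rightarrow> 'k) \<Rightarrow> nat set \<Rightarrow> 'a \<Rightarrow> 'a"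
  where "coord_proj sc e f A x = (\<Sum>n\<in>A. sc (f n x) (e n))"

text \<open>
  For a semi-normalized system the constants below are finite, so real suprema and infima are
  adequate: the norms of \<open>I - P\<^sub>A\<close> with \<open>|A| \<le> N\<close> are bounded by \<open>1 + N \<kappa>\<^sub>2\<^sup>2\<close>.
\<close>

definition compl_proj_const ::
  "('k::real_normed_field \<Rightarrow> 'a::banach \<Rightarrow> 'a) \<Rightarrow> (nat \<Rightarrow> 'a) \<Rightarrow> (nat \<Rightarrow> 'a \<Rightarrow> 'k) \<Rightarrow> nat \<Rightarrow> real"
  where "compl_proj_const sc e f N =
    (SUP A\<in>{A. finite A \<and> card A \<le> N}. onorm (\<lambda>x::'a. x - coord_proj sc e f A x))"

definition greedy_sets :: "(nat \<Rightarrow> 'a \<Rightarrow> 'k::real_normed_field) \<Rightarrow> 'a \<Rightarrow> nat \<Rightarrow> nat set set"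
  where "greedy_sets f x N =
    {\<Gamma>. finite \<Gamma> \<and> card \<Gamma> = N \<and> (\<forall>n\<in>\<Gamma>. \<forall>m\<in>-\<Gamma>. norm (f n x) \<ge> norm (f m x))}"

definition greedy_maps ::
  "('k::real_normed_field \<Rightarrow> 'a::banach \<Rightarrow> 'a) \<Rightarrow> (nat \<Rightarrow> 'a) \<Rightarrow> (nat \<Rightarrow> 'a \<Rightarrow> 'k) \<Rightarrow> nat \<Rightarrow> ('a \<Rightarrow> 'a) set"
  where "greedy_maps sc e f N =
    {G. \<forall>x. \<exists>\<Gamma>\<in>greedy_sets f x N. G x = coord_proj sc e f \<Gamma> x}"

definition sparse_vectors ::
  "('k::real_normed_field \<Rightarrow> 'a::banach \<Rightarrow> 'a) \<Rightarrow> (nat \<Rightarrow> 'a) \<Rightarrow> nat \<Rightarrow> 'a set"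
  where "sparse_vectors sc e N = {\<Sum>n\<in>A. sc (a n) (e n) | A a. finite A \<and> card A \<le> N}"

definition best_error :: "('k::real_normed_field \<Rightarrow> 'a::banach \<Rightarrow> 'a) \<Rightarrow> (nat \<Rightarrow> 'a) \<Rightarrow> nat \<Rightarrow> 'a \<Rightarrow> real"
  where "best_error sc e N x = infdist x (sparse_vectors sc e N)"

definition proj_error ::
  "('k::real_normed_field \<Rightarrow> 'a::banach \<Rightarrow> 'a) \<Rightarrow> (nat \<Rightarrow> 'a) \<Rightarrow> (nat \<Rightarrow> 'a \<Rightarrow> 'k) \<Rightarrow> nat \<Rightarrow> 'a \<Rightarrow> real"
  where "proj_error sc e f N x =
    (INF A\<in>{A. finite A \<and> card A \<le> N}. norm (x - coord_proj sc e f A x))"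

text \<open>
  The least constants exist: greedy maps exist because \<open>f n x \<longlonglongrightarrow> 0\<close>, the constant
  \<open>1 + 3 N \<kappa>\<^sub>2\<^sup>2\<close> is admissible, and the errors are not identically zero.
\<close>

definition lebesgue_const ::
  "('k::real_normed_field \<Rightarrow> 'a::banach \<Rightarrow> 'a) \<Rightarrow> (nat \<Rightarrow> 'a) \<Rightarrow> (nat \<Rightarrow> 'a \<Rightarrow> 'k) \<Rightarrow> nat \<Rightarrow> real"
  where "lebesgue_const sc e f N =
    (LEAST C. \<forall>x. \<forall>G\<in>greedy_maps sc e f N. norm (x - G x) \<le> C * best_error sc e N x)"

definition proj_lebesgue_const ::
  "('k::real_normed_field \<Rightarrow> 'a::banach \<Rightarrow> 'a) \<Rightarrow> (nat \<Rightarrow> 'a) \<Rightarrow> (nat \<Rightarrow> 'a \<Rightarrow> 'k) \<Rightarrow> nat \<Rightarrow> real"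
  where "proj_lebesgue_const sc e f N =
    (LEAST C. \<forall>x. \<forall>G\<in>greedy_maps sc e f N. norm (x - G x) \<le> C * proj_error sc e f N x)"

definition sign_seqs :: "(nat \<Rightarrow> 'k::real_normed_field) set"
  where "sign_seqs = {\<epsilon>. \<forall>n. norm (\<epsilon> n) = 1}"

definition signed_indicator ::
  "('k::real_normed_field \<Rightarrow> 'a::banach \<Rightarrow> 'a) \<Rightarrow> (nat \<Rightarrow> 'a) \<Rightarrow> (nat \<Rightarrow> 'k) \<Rightarrow> nat set \<Rightarrow> 'a"
  where "signed_indicator sc e \<epsilon> A = (\<Sum>n\<in>A. sc (\<epsilon> n) (e n))"

definition coeff_sup :: "(nat \<Rightarrow> 'a \<Rightarrow> 'k::real_normed_field) \<Rightarrow> 'a \<Rightarrow> real"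
  where "coeff_sup f x = (SUP n. norm (f n x))"

definition coeff_supp :: "(nat \<Rightarrow> 'a \<Rightarrow> 'k::real_normed_field) \<Rightarrow> 'a \<Rightarrow> nat set"
  where "coeff_supp f x = {n. f n x \<noteq> 0}"

text \<open>
  The denominators are at least \<open>1 / \<kappa>\<^sub>2\<close>, since \<open>B\<close> is nonempty and disjoint from the support
  of \<open>x\<close>, and the quotients are bounded by \<open>1 + 2 N \<kappa>\<^sub>2\<^sup>2\<close>.
\<close>

definition democracy_const ::
  "('k::real_normed_field \<Rightarrow> 'a::banach \<Rightarrow> 'a) \<Rightarrow> (nat \<Rightarrow> 'a) \<Rightarrow> (nat \<Rightarrow> 'a \<Rightarrow> 'k) \<Rightarrow> nat \<Rightarrow> real"
  where "democracy_const sc e f N =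
    Sup {norm (signed_indicator sc e \<epsilon> A + x) / norm (signed_indicator sc e \<eta> B + x) | A B \<epsilon> \<eta> x.
      finite A \<and> finite B \<and> A \<noteq> {} \<and> B \<noteq> {} \<and> card A = card B \<and> card B \<le> N \<and>
      \<epsilon> \<in> sign_seqs \<and> \<eta> \<in> sign_seqs \<and> coeff_sup f x \<le> 1 \<and>
      A \<inter> B = {} \<and> A \<inter> coeff_supp f x = {} \<and> B \<inter> coeff_supp f x = {}}"

end

theory Submission imports Defs begin

text \<open>
  Since \<open>I - P\<^sub>A\<close> is a contraction when \<open>A\<close> is a singleton, so is every \<open>I - P\<^sub>A\<close> with \<open>A\<close> finite, whatever its
  size. Let \<open>\<Gamma>\<close> be a greedy set for \<open>x\<close>, let \<open>z\<close> be supported on \<open>A\<close> with \<open>|A| = N = |\<Gamma>|\<close>, and let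
  \<open>t\<close> be the least modulus of a coefficient of \<open>x\<close> on \<open>\<Gamma> - A\<close>. With \<open>u = x - P x\<close> for the projection
  \<open>P\<close> onto \<open>A \<union> \<Gamma>\<close>, the remainder of \<open>x\<close> is \<open>u\<close> plus its part on \<open>A - \<Gamma>\<close>. By convexity that part can be
  replaced by \<open>t\<close> times unimodular coefficients, by the definition of \<open>\<nu>\<^sub>N\<close> it can be moved to
  \<open>\<Gamma> - A\<close>, and there the coefficients of \<open>x\<close>, which are those of \<open>x - z\<close>, can be truncated to modulus
  \<open>t\<close> because the projections \<open>I - P\<^sub>A\<close> are contractions. Hence \<open>L\<^sub>N \<le> \<nu>\<^sub>N\<close>. Conversely, any admissible
  constant bounds the quotients defining \<open>\<nu>\<^sub>N\<close>: apply the inequality to the sum of both signed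
  indicators, \<open>x\<close>, and a far-out indicator, with ties between the coefficients of modulus \<open>1\<close> broken
  in favour of \<open>B\<close>.
\<close>

context seminormalized_biorthogonal_system
begin

section \<open>Coordinate functionals and coordinate projections\<close>

abbreviation P :: "nat set \<Rightarrow> 'a \<Rightarrow> 'a"
  where "P \<equiv> coord_proj sc e f"

lemmas coord_simps =
  Vector_Spaces.linear.axioms(3)[OF linear_f, THEN module_hom.add]
  Vector_Spaces.linear.axioms(3)[OF linear_f, THEN module_hom.scale]
  Vector_Spaces.linear.axioms(3)[OF linear_f, THEN module_hom.diff]
  Vector_Spaces.linear.axioms(3)[OF linear_f, THEN module_hom.zero]
  Vector_Spaces.linear.axioms(3)[OF linear_f, THEN module_hom.sum]

lemma coord_scaleR: "f n (r *\<^sub>R x) = of_real r * f n x"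
  using coord_simps(2)[of n "of_real r" x] by (simp add: sc_of_real)

lemma sc_of_real_mult: "sc (of_real r * c) x = r *\<^sub>R sc c x"
  by (simp flip: sc_of_real)

lemma uniform_bound:
  "\<exists>K>0. (\<forall>n. norm (e n) \<le> K) \<and> (\<forall>n x. norm (f n x) \<le> K * norm x)"
proof -
  from seminormalized obtain k K where k: "0 < k"
    "\<And>n. k \<le> norm (e n) \<and> norm (e n) \<le> K \<and> k \<le> onorm (f n) \<and> onorm (f n) \<le> K"
    by blast
  have "norm (f n x) \<le> K * norm x" for n x
    using onorm[OF bounded_linear_f, of n x] k(2)[of n]
    by (meson mult_right_mono norm_ge_zero order_trans)
  moreover have "K > 0" using k(1) k(2)[of 0] by linarith
  ultimately show ?thesis using k(2) by blast
qed

lemma coord_sum: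
  assumes "finite A"
  shows "f n (\<Sum>m\<in>A. sc (a m) (e m)) = (if n \<in> A then a n else 0)"
proof -
  have "f n (\<Sum>m\<in>A. sc (a m) (e m)) = (\<Sum>m\<in>A. if n = m then a m else 0)"
    unfolding coord_simps by (intro sum.cong) (auto simp: biorthogonal)
  then show ?thesis using assms by simp
qed

lemma coord_coord_proj: "finite A \<Longrightarrow> f n (P A x) = (if n \<in> A then f n x else 0)"
  unfolding coord_proj_def by (rule coord_sum)

lemma coord_signed_indicator:
  "finite A \<Longrightarrow> f n (signed_indicator sc e \<epsilon> A) = (if n \<in> A then \<epsilon> n else 0)"
  unfolding signed_indicator_def by (rule coord_sum)

lemma coord_proj_add: "P A (x + y) = P A x + P A y"
  by (simp add: coord_proj_def coord_simps scale_left_distrib sum.distrib)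

lemma coord_proj_diff: "P A (x - y) = P A x - P A y"
  by (simp add: coord_proj_def coord_simps scale_left_diff_distrib sum_subtractf)

lemma coord_proj_eq:
  assumes "\<And>n. n \<in> A \<Longrightarrow> f n x = f n y"
  shows "P A x = P A y"
  unfolding coord_proj_def using assms by (intro sum.cong) auto

lemma coord_proj_zero:
  assumes "\<And>n. n \<in> A \<Longrightarrow> f n x = 0"
  shows "P A x = 0"
  unfolding coord_proj_def using assms by (intro sum.neutral) auto

lemma coord_proj_Un:
  assumes "finite A" "finite B" "A \<inter> B = {}"
  shows "P (A \<union> B) x = P A x + P B x"
  unfolding coord_proj_def using assms by (rule sum.union_disjoint)

lemma coord_proj_sum:
  assumes "finite A" "A \<subseteq> B" "finite B"
  shows "P B (\<Sum>m\<in>A. sc (a m) (e m)) = (\<Sum>m\<in>A. sc (a m) (e m))"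
  unfolding coord_proj_def coord_sum[OF assms(1)]
  using assms by (intro sum.mono_neutral_cong_right) auto

lemma coord_proj_signed_indicator:
  assumes "finite A" "A \<subseteq> B" "finite B"
  shows "P B (signed_indicator sc e \<epsilon> A) = signed_indicator sc e \<epsilon> A"
  unfolding signed_indicator_def using assms by (rule coord_proj_sum)

lemma norm_coord_proj_le:
  fixes K d :: real
  assumes "\<And>n. norm (e n) \<le> K" "\<And>n. n \<in> A \<Longrightarrow> norm (f n x) \<le> d" "d \<ge> 0"
  shows "norm (P A x) \<le> card A * (d * K)"
  unfolding coord_proj_def
  using assms by (intro sum_norm_bound) (simp add: norm_sc mult_mono)

lemma bounded_linear_coord_proj: "bounded_linear (P A)"
proof -
  obtain K where K: "K > 0" "\<And>n. norm (e n) \<le> K" "\<And>n x. norm (f n x) \<le> K * norm x"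
    using uniform_bound by blast
  show ?thesis
  proof (rule bounded_linear_intro)
    show "P A (x + y) = P A x + P A y" for x y by (rule coord_proj_add)
    show "P A (r *\<^sub>R x) = r *\<^sub>R P A x" for r x
      by (simp add: coord_proj_def coord_scaleR sc_of_real_mult scaleR_sum_right)
    show "norm (P A x) \<le> norm x * (card A * (K * K))" for x
      using norm_coord_proj_le[of K A x "K * norm x"] K by (simp add: mult_ac)
  qed
qed

section \<open>Decay of coefficients; existence of greedy sets and greedy maps\<close>

text \<open>By density of the span, \<open>x\<close> is within \<open>d / K\<close> of some
  \<open>y\<close> with finitely many nonzero coefficients. The functionals are bounded by
  \<open>K\<close>, so off the support of \<open>y\<close> the coefficients of \<open>x\<close> stay
  below \<open>d\<close>.\<close>

lemma finite_large_coords: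
  assumes "d > 0"
  shows "finite {n. norm (f n x) \<ge> d}"
proof -
  obtain K where K: "K > 0" "\<And>n. norm (e n) \<le> K" "\<And>n x. norm (f n x) \<le> K * norm x"
    using uniform_bound by blast
  have "x \<in> closure (span (range e))" using dense_span by simp
  then obtain y where y: "y \<in> span (range e)" "dist y x < d / K"
    using assms K(1) by (meson closure_approachable divide_pos_pos)
  have "subspace {y. finite {n. f n y \<noteq> 0}}"
  proof (rule subspaceI)
    show "0 \<in> {y. finite {n. f n y \<noteq> 0}}" by (simp add: coord_simps)
    show "v + w \<in> {y. finite {n. f n y \<noteq> 0}}"
      if "v \<in> {y. finite {n. f n y \<noteq> 0}}" "w \<in> {y. finite {n. f n y \<noteq> 0}}" for v w
    proof -
      have "{n. f n (v + w) \<noteq> 0} \<subseteq> {n. f n v \<noteq> 0} \<union> {n. f n w \<noteq> 0}"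
        by (auto simp: coord_simps)
      then show ?thesis using that by (simp add: finite_subset)
    qed
    show "sc c v \<in> {y. finite {n. f n y \<noteq> 0}}"
      if "v \<in> {y. finite {n. f n y \<noteq> 0}}" for c v
      using that by (simp add: coord_simps)
  qed
  moreover have "range e \<subseteq> {y. finite {n. f n y \<noteq> 0}}"
    by (auto simp: biorthogonal)
  ultimately have "finite {n. f n y \<noteq> 0}" using y(1) span_minimal by blast
  moreover have "norm (f n x) < d" if "f n y = 0" for n
  proof -
    have "norm (f n x) \<le> K * norm (x - y)"
      using K(3)[of n "x - y"] that by (simp add: coord_simps)
    also have "\<dots> < d" using y(2) K(1) by (simp add: dist_norm norm_minus_commute field_simps)
    finally show ?thesis .
  qed
  then have "{n. d \<le> norm (f n x)} \<subseteq> {n. f n y \<noteq> 0}" by force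
  ultimately show ?thesis by (rule rev_finite_subset)
qed

text \<open>A greedy set grows by an index of the largest remaining coefficient. That maximum is
  attained because only finitely many coefficients are as large as a given nonzero one.\<close>

lemma greedy_sets_nonempty: "greedy_sets f x N \<noteq> {}"
proof (induction N)
  case 0
  have "{} \<in> greedy_sets f x 0" by (simp add: greedy_sets_def)
  then show ?case by blast
next
  case (Suc N)
  then obtain G where G: "finite G" "card G = N"
    "\<And>n m. n \<in> G \<Longrightarrow> m \<notin> G \<Longrightarrow> norm (f m x) \<le> norm (f n x)"
    by (auto simp: greedy_sets_def)
  obtain k where k: "k \<notin> G" "\<And>m. m \<notin> G \<Longrightarrow> norm (f m x) \<le> norm (f k x)"
  proof (cases "\<forall>m. m \<notin> G \<longrightarrow> f m x = 0")
    case True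
    obtain k where "k \<notin> G" using ex_new_if_finite[OF infinite_UNIV_nat G(1)] by blast
    then show thesis using that True by simp
  next
    case False
    then obtain m where m: "m \<notin> G" "f m x \<noteq> 0" by blast
    define S where "S = {n. norm (f n x) \<ge> norm (f m x)} - G"
    have S: "finite S" "m \<in> S" using m finite_large_coords[of "norm (f m x)" x]
      by (auto simp: S_def)
    let ?g = "\<lambda>n. norm (f n x)"
    have "Max (?g ` S) \<in> ?g ` S" using S by (intro Max_in) auto
    then obtain k where k: "k \<in> S" "?g k = Max (?g ` S)" by force
    have kS: "?g n \<le> ?g k" if "n \<in> S" for n
      using S(1) that unfolding k(2) by simp
    \<comment> \<open>Outside \<open>G\<close> and \<open>S\<close> the coefficients are smaller
      than the one at \<open>m\<close>, which itself competes in the maximum.\<close>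
    have "norm (f n x) \<le> norm (f k x)" if "n \<notin> G" for n
      using kS[of n] kS[OF S(2)] that by (cases "n \<in> S") (auto simp: S_def)
    then show thesis using that k(1) by (auto simp: S_def)
  qed
  have "insert k G \<in> greedy_sets f x (Suc N)"
    using G k by (auto simp: greedy_sets_def)
  then show ?case by blast
qed

text \<open>Lets an inequality about all greedy maps be tested on any chosen greedy set of a single
  vector.\<close>

lemma greedy_map_exists:
  assumes "S \<in> greedy_sets f y N"
  obtains G where "G \<in> greedy_maps sc e f N" "G y = P S y"
proof
  define T where "T x = (if x = y then S else SOME T. T \<in> greedy_sets f x N)" for x
  have "T x \<in> greedy_sets f x N" for x
    using assms greedy_sets_nonempty[of x N] by (auto simp: T_def some_in_eq)
  then show "(\<lambda>x. P (T x) x) \<in> greedy_maps sc e f N" by (auto simp: greedy_maps_def)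
  show "P (T y) y = P S y" by (simp add: T_def)
qed

lemma coeff_sup_le_iff: "coeff_sup f x \<le> c \<longleftrightarrow> (\<forall>n. norm (f n x) \<le> c)"
proof -
  obtain K where K: "K > 0" "\<And>n. norm (e n) \<le> K" "\<And>n x. norm (f n x) \<le> K * norm x"
    using uniform_bound by blast
  have "bdd_above (range (\<lambda>n. norm (f n x)))" using K(3) by (intro bdd_aboveI2)
  then show ?thesis by (simp add: coeff_sup_def cSUP_le_iff)
qed

section \<open>Convexity and contractive projections\<close>

text \<open>The norm is convex in each coefficient separately, so coefficients can be pushed to
  modulus \<open>t\<close> one at a time.\<close>

lemma norm_sum_le_corners:
  assumes "finite A" "t > 0" "\<And>n. n \<in> A \<Longrightarrow> norm (a n) \<le> t"
    and "\<And>\<epsilon>. \<epsilon> \<in> sign_seqs \<Longrightarrow> norm (t *\<^sub>R signed_indicator sc e \<epsilon> A + u) \<le> M"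
  shows "norm ((\<Sum>n\<in>A. sc (a n) (e n)) + u) \<le> M"
  using assms(1,3,4)
proof (induction A arbitrary: u rule: finite_induct)
  case empty
  have "(\<lambda>_. 1) \<in> sign_seqs" by (simp add: sign_seqs_def)
  then show ?case using empty.prems(2) by (force simp: signed_indicator_def)
next
  case (insert n A)
  txt \<open>The scalar \<open>a n\<close> is a convex combination of \<open>t * s\<close> and \<open>- t * s\<close>, over any field \<open>'k\<close>.\<close>
  define s where "s = (if a n = 0 then 1 else sgn (a n))"
  have s: "norm s = 1" "a n = of_real (norm (a n)) * s"
    by (simp_all add: s_def norm_sgn) (simp add: sgn_div_norm scaleR_conv_of_real)
  define w where "w = t *\<^sub>R sc s (e n)"
  define l where "l = (1 + norm (a n) / t) / 2"
  have l: "0 \<le> l" "l \<le> 1"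
    using assms(2) insert.prems(1)[of n] by (simp_all add: l_def field_simps)
  have an: "sc (a n) (e n) = l *\<^sub>R w + (1 - l) *\<^sub>R (- w)"
  proof -
    have "sc (a n) (e n) = norm (a n) *\<^sub>R sc s (e n)"
      by (subst s(2)) (rule sc_of_real_mult)
    also have "\<dots> = (2 * l - 1) *\<^sub>R w"
      using assms(2) by (simp add: l_def w_def add_divide_distrib)
    also have "\<dots> = l *\<^sub>R w + (1 - l) *\<^sub>R (- w)"
      by (simp add: algebra_simps flip: scaleR_left_distrib)
    finally show ?thesis .
  qed
  \<comment> \<open>The term at \<open>n\<close> joins the offset \<open>u\<close>, which the
    induction leaves arbitrary. Only the corners over \<open>A\<close> then need a bound.\<close>
  have "norm ((\<Sum>m\<in>A. sc (a m) (e m)) + (sc (a n) (e n) + u)) \<le> M"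
  proof (rule insert.IH)
    show "norm (a m) \<le> t" if "m \<in> A" for m using insert.prems(1) that by simp
    fix \<epsilon> :: "nat \<Rightarrow> 'k" assume \<epsilon>: "\<epsilon> \<in> sign_seqs"
    define v where "v = t *\<^sub>R signed_indicator sc e \<epsilon> A + u"
    have split: "t *\<^sub>R signed_indicator sc e (\<epsilon>(n := r)) (insert n A) + u = v + t *\<^sub>R sc r (e n)" for r
    proof -
      have "(\<Sum>m\<in>A. sc ((\<epsilon>(n := r)) m) (e m)) = (\<Sum>m\<in>A. sc (\<epsilon> m) (e m))"
        using insert.hyps by (intro sum.cong) auto
      then show ?thesis
        using insert.hyps by (simp add: signed_indicator_def v_def scaleR_right_distrib)
    qed
    have le: "norm (v + t *\<^sub>R sc r (e n)) \<le> M" if "norm r = 1" for r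
      using insert.prems(2)[of "\<epsilon>(n := r)"] that \<epsilon> unfolding split by (simp add: sign_seqs_def)
    have "norm (v + w) \<le> M" using le[of s] s(1) by (simp add: w_def)
    moreover have "norm (v - w) \<le> M"
      using le[of "- s"] s(1) by (simp add: w_def scale_minus_left)
    moreover have "v + sc (a n) (e n) = l *\<^sub>R (v + w) + (1 - l) *\<^sub>R (v - w)"
      unfolding an by (simp add: algebra_simps)
    ultimately have "norm (v + sc (a n) (e n)) \<le> l * M + (1 - l) * M"
      using l by (simp only:) (intro norm_triangle_le add_mono; simp add: mult_left_mono)
    then show "norm (t *\<^sub>R signed_indicator sc e \<epsilon> A + (sc (a n) (e n) + u)) \<le> M"
      by (simp add: v_def algebra_simps)
  qed
  then show ?case using insert.hyps by (simp add: add_ac)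
qed

text \<open>\<open>I - P A\<close> is a composition of the maps \<open>I - P {n}\<close> with
  \<open>n\<close> in \<open>A\<close>, and each of these has norm at most 1 because
  \<open>N\<close> is at least 1.\<close>

lemma norm_coord_proj_compl_le:
  assumes "compl_proj_const sc e f N = 1" "N \<ge> 1" "finite A"
  shows "norm (x - P A x) \<le> norm x"
  using assms(3)
proof (induction A rule: finite_induct)
  case empty
  show ?case by (simp add: coord_proj_def)
next
  case (insert n A)
  let ?Q = "\<lambda>A x. x - P A x"
  obtain K where K: "K > 0" "\<And>n. norm (e n) \<le> K" "\<And>n x. norm (f n x) \<le> K * norm x"
    using uniform_bound by blast
  have bl: "bounded_linear (?Q A)" for A
    by (intro bounded_linear_sub bounded_linear_ident bounded_linear_coord_proj)
  \<comment> \<open>A crude bound, whose only purpose is that the real supremum defining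
    \<open>compl_proj_const\<close> is taken over a bounded set.\<close>
  have "onorm (?Q A) \<le> 1 + N * (K * K)" if "card A \<le> N" for A
  proof (rule onorm_bound)
    fix x
    have "norm (P A x) \<le> card A * (K * norm x * K)"
      using K by (intro norm_coord_proj_le) auto
    also have "\<dots> \<le> N * (K * norm x * K)"
      using that K by (intro mult_right_mono) auto
    finally show "norm (x - P A x) \<le> (1 + N * (K * K)) * norm x"
      using norm_triangle_ineq4[of x "P A x"] by (simp add: algebra_simps)
  qed (use K in simp)
  then have "bdd_above ((\<lambda>A. onorm (?Q A)) ` {A. finite A \<and> card A \<le> N})"
    by (intro bdd_aboveI2) auto
  then have "onorm (?Q {n}) \<le> compl_proj_const sc e f N"
    unfolding compl_proj_const_def using assms(2) by (intro cSUP_upper) auto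
  then have Q: "norm (?Q {n} x) \<le> norm x" for x
    using onorm[OF bl[of "{n}"], of x] assms(1)
    by (metis mult_left_le_one_le mult_right_mono norm_ge_zero order_trans mult_1)
  have "?Q (insert n A) x = ?Q {n} (?Q A x)"
  proof -
    have "P {n} (P A x) = 0" using insert.hyps
      by (intro coord_proj_zero) (simp add: coord_coord_proj)
    moreover have "P (insert n A) x = P {n} x + P A x"
      using coord_proj_Un[of "{n}" A x] insert.hyps by simp
    ultimately show ?thesis by (simp add: coord_proj_diff)
  qed
  then show ?case using Q insert.IH by (metis order_trans)
qed

text \<open>\<open>I - c P\<^sub>A\<close> is a convex combination of \<open>I\<close> and \<open>I - P\<^sub>A\<close>, used with \<open>A\<close> a singleton.\<close>

lemma norm_truncate_le:
  assumes "compl_proj_const sc e f N = 1" "N \<ge> 1" "finite A"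
    and "\<And>n. n \<in> A \<Longrightarrow> 0 \<le> c n \<and> c n \<le> 1"
  shows "norm (x - (\<Sum>n\<in>A. c n *\<^sub>R sc (f n x) (e n))) \<le> norm x"
  using assms(3,4)
proof (induction A rule: finite_induct)
  case empty
  show ?case by simp
next
  case (insert n A)
  define y where "y = x - (\<Sum>m\<in>A. c m *\<^sub>R sc (f m x) (e m))"
  \<comment> \<open>The earlier truncations leave the coefficient at \<open>n\<close> unchanged, so
    shrinking it in \<open>y\<close> is the same as shrinking it in \<open>x\<close>.\<close>
  have "f n (\<Sum>m\<in>A. sc (of_real (c m) * f m x) (e m)) = 0"
    using insert.hyps by (simp add: coord_sum)
  then have fy: "f n y = f n x" by (simp add: y_def coord_simps sc_of_real_mult)
  have c: "0 \<le> c n" "c n \<le> 1" using insert.prems by auto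
  have "x - (\<Sum>m\<in>insert n A. c m *\<^sub>R sc (f m x) (e m)) = (1 - c n) *\<^sub>R y + c n *\<^sub>R (y - P {n} y)"
    using insert.hyps fy by (simp add: coord_proj_def y_def algebra_simps)
  also have "norm \<dots> \<le> (1 - c n) * norm y + c n * norm (y - P {n} y)"
    using c by (intro norm_triangle_le) simp
  also have "\<dots> \<le> (1 - c n) * norm y + c n * norm y"
    using c norm_coord_proj_compl_le[OF assms(1,2), of "{n}" y]
    by (intro add_mono mult_left_mono) auto
  also have "\<dots> = norm y" by (simp add: algebra_simps)
  also have "\<dots> \<le> norm x" using insert by (simp add: y_def)
  finally show ?case .
qed

section \<open>Finiteness and elementary bounds of the constant \<nu>\<close>

definition democracy_quotients :: "nat \<Rightarrow> real set" where
  "democracy_quotients N =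
    {norm (signed_indicator sc e \<epsilon> A + x) / norm (signed_indicator sc e \<eta> B + x) | A B \<epsilon> \<eta> x.
      finite A \<and> finite B \<and> A \<noteq> {} \<and> B \<noteq> {} \<and> card A = card B \<and> card B \<le> N \<and>
      \<epsilon> \<in> sign_seqs \<and> \<eta> \<in> sign_seqs \<and> coeff_sup f x \<le> 1 \<and>
      A \<inter> B = {} \<and> A \<inter> coeff_supp f x = {} \<and> B \<inter> coeff_supp f x = {}}"

lemma democracy_const_eq: "democracy_const sc e f N = Sup (democracy_quotients N)"
  by (simp add: democracy_const_def democracy_quotients_def)

lemma norm_signed_indicator_le:
  fixes K :: real
  assumes "\<And>n. norm (e n) \<le> K" "\<epsilon> \<in> sign_seqs"
  shows "norm (signed_indicator sc e \<epsilon> A) \<le> card A * K"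
  unfolding signed_indicator_def
  using assms by (intro sum_norm_bound) (simp add: norm_sc sign_seqs_def)

text \<open>A coordinate functional at an index of \<open>A\<close> has modulus 1 on this vector,
  which keeps the denominators away from zero.\<close>

lemma norm_signed_indicator_pos:
  assumes "finite A" "A \<noteq> {}" "\<epsilon> \<in> sign_seqs" "A \<inter> coeff_supp f x = {}"
    and "\<And>n x. norm (f n x) \<le> K * norm x"
  shows "1 \<le> K * norm (signed_indicator sc e \<epsilon> A + x)"
proof -
  obtain n where n: "n \<in> A" using assms(2) by blast
  then have "f n x = 0" using assms(4) by (auto simp: coeff_supp_def)
  then have "norm (f n (signed_indicator sc e \<epsilon> A + x)) = 1"
    using n assms(1,3) by (simp add: coord_simps coord_signed_indicator sign_seqs_def)
  then show ?thesis using assms(5) by metis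
qed

lemma signed_indicator_add_nonzero:
  assumes "finite A" "A \<noteq> {}" "\<epsilon> \<in> sign_seqs" "A \<inter> coeff_supp f x = {}"
  shows "signed_indicator sc e \<epsilon> A + x \<noteq> 0"
proof -
  obtain K where K: "K > 0" "\<And>n. norm (e n) \<le> K" "\<And>n x. norm (f n x) \<le> K * norm x"
    using uniform_bound by blast
  then show ?thesis using norm_signed_indicator_pos[OF assms K(3)] by force
qed

text \<open>Applying \<open>I - P B\<close> to the denominator vector leaves \<open>x\<close>, so
  the denominator dominates the norm of \<open>x\<close>; the signed indicator in the numerator
  costs at most \<open>N * K\<close>.\<close>

lemma bdd_above_democracy_quotients:
  assumes "compl_proj_const sc e f N = 1" "N \<ge> 1"
  shows "bdd_above (democracy_quotients N)"
proof -
  obtain K where K: "K > 0" "\<And>n. norm (e n) \<le> K" "\<And>n x. norm (f n x) \<le> K * norm x"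
    using uniform_bound by blast
  have "norm (signed_indicator sc e \<epsilon> A + x) / norm (signed_indicator sc e \<eta> B + x) \<le> 1 + N * K * K"
    if "finite A" "finite B" "A \<noteq> {}" "B \<noteq> {}" "card A = card B" "card B \<le> N"
      "\<epsilon> \<in> sign_seqs" "\<eta> \<in> sign_seqs" "B \<inter> coeff_supp f x = {}" for A B \<epsilon> \<eta> x
  proof -
    let ?D = "norm (signed_indicator sc e \<eta> B + x)"
    have D: "1 \<le> K * ?D" using norm_signed_indicator_pos that K(3) by blast
    then have "?D > 0" by (metis K(1) linorder_not_le mult_nonneg_nonpos not_one_le_zero order_trans less_imp_le)
    have "P B x = 0" using that(9) by (intro coord_proj_zero) (auto simp: coeff_supp_def)
    then have "P B (signed_indicator sc e \<eta> B + x) = signed_indicator sc e \<eta> B"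
      using that(2) by (simp add: coord_proj_add coord_proj_signed_indicator)
    then have "norm x \<le> ?D"
      using norm_coord_proj_compl_le[OF assms that(2), of "signed_indicator sc e \<eta> B + x"] by simp
    moreover have "norm (signed_indicator sc e \<epsilon> A) \<le> card A * K"
      using norm_signed_indicator_le K(2) that(7) by blast
    moreover have "card A * K \<le> N * K" using K(1) that by (intro mult_right_mono) auto
    moreover have "N * K * 1 \<le> N * K * (K * ?D)" using K(1) D by (intro mult_left_mono) auto
    ultimately have "norm (signed_indicator sc e \<epsilon> A + x) \<le> (1 + N * K * K) * ?D"
      using norm_triangle_ineq[of "signed_indicator sc e \<epsilon> A" x] by (simp add: algebra_simps)
    then show ?thesis using \<open>?D > 0\<close> by (simp add: divide_le_eq)
  qed
  then show ?thesis
    unfolding democracy_quotients_def by (intro bdd_aboveI[of _ "1 + N * K * K"]) blast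
qed

lemma democracy_const_upper:
  assumes "compl_proj_const sc e f N = 1" "N \<ge> 1"
    and "finite A" "finite B" "A \<noteq> {}" "B \<noteq> {}" "card A = card B" "card B \<le> N"
      "\<epsilon> \<in> sign_seqs" "\<eta> \<in> sign_seqs" "\<And>n. norm (f n x) \<le> 1"
      "A \<inter> B = {}" "A \<inter> coeff_supp f x = {}" "B \<inter> coeff_supp f x = {}"
  shows "norm (signed_indicator sc e \<epsilon> A + x) \<le>
    democracy_const sc e f N * norm (signed_indicator sc e \<eta> B + x)"
proof -
  have "coeff_sup f x \<le> 1" using assms(11) by (simp add: coeff_sup_le_iff)
  then have "norm (signed_indicator sc e \<epsilon> A + x) / norm (signed_indicator sc e \<eta> B + x)
      \<in> democracy_quotients N"
    unfolding democracy_quotients_def using assms(3-) by blast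
  then have "norm (signed_indicator sc e \<epsilon> A + x) / norm (signed_indicator sc e \<eta> B + x)
      \<le> democracy_const sc e f N"
    unfolding democracy_const_eq by (rule cSup_upper) (rule bdd_above_democracy_quotients[OF assms(1,2)])
  then show ?thesis
    using signed_indicator_add_nonzero[OF assms(4,6,10,14)] by (simp add: divide_le_eq)
qed

text \<open>Comparing two basis vectors in both directions: a constant below 1 would make each
  strictly shorter than the other.\<close>

lemma democracy_const_ge_1:
  assumes "compl_proj_const sc e f N = 1" "N \<ge> 1"
  shows "democracy_const sc e f N \<ge> 1"
proof -
  let ?s = "\<lambda>n::nat. norm (signed_indicator sc e (\<lambda>_. 1) {n} + 0)"
  let ?d = "democracy_const sc e f N"
  have s: "(\<lambda>_. 1) \<in> (sign_seqs :: (nat \<Rightarrow> 'k) set)" by (simp add: sign_seqs_def)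
  have le: "?s m \<le> ?d * ?s n" if "m \<noteq> n" for m n
    by (rule democracy_const_upper[OF assms]) (use s assms that in \<open>simp_all add: coord_simps coeff_supp_def\<close>)
  have pos: "?s n > 0" for n
    using signed_indicator_add_nonzero[of "{n}" "\<lambda>_. 1" 0] s by (simp add: coord_simps coeff_supp_def)
  show ?thesis
  proof (rule ccontr)
    assume "\<not> ?d \<ge> 1"
    then have "?d * ?s n < ?s n" for n using pos[of n] by simp
    then show False using le[of 0 1] le[of 1 0] by (smt (verit) zero_neq_one)
  qed
qed

section \<open>Upper bound for the greedy remainder\<close>

text \<open>The cardinality of \<open>A\<close> is exactly \<open>N\<close> so that
  \<open>A - G\<close> and \<open>G - A\<close> are equinumerous, as a comparison through \<nu>
  requires.\<close>

lemma norm_greedy_le: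
  assumes k: "compl_proj_const sc e f N = 1" "N \<ge> 1"
    and G: "G \<in> greedy_sets f x N" and A: "finite A" "card A = N"
  shows "norm (x - P G x) \<le> democracy_const sc e f N * norm (x - (\<Sum>n\<in>A. sc (a n) (e n)))"
proof -
  let ?d = "democracy_const sc e f N"
  define y where "y = x - (\<Sum>n\<in>A. sc (a n) (e n))"
  have G: "finite G" "card G = N"
    "\<And>n m. n \<in> G \<Longrightarrow> m \<notin> G \<Longrightarrow> norm (f m x) \<le> norm (f n x)"
    using G by (auto simp: greedy_sets_def)
  define u where "u = x - P (A \<union> G) x"
  \<comment> \<open>The approximant is fixed by \<open>P (A \<union> G)\<close>, so \<open>u\<close>
    is also a remainder of \<open>y\<close> and is controlled by it.\<close>
  have uy: "u = y - P (A \<union> G) y"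
    using A(1) G(1) by (simp add: u_def y_def coord_proj_diff coord_proj_sum)
  have fu: "f n u = (if n \<in> A \<union> G then 0 else f n x)" for n
    unfolding u_def using A(1) G(1) by (simp add: coord_simps coord_coord_proj)
  have fy: "f n y = f n x" if "n \<notin> A" for n
    using A(1) that by (simp add: y_def coord_simps(3) coord_sum)
  have u_le: "norm u \<le> norm y"
    unfolding uy using norm_coord_proj_compl_le[OF k] A(1) G(1) by simp
  have d1: "?d \<ge> 1" using k by (rule democracy_const_ge_1)
  define D where "D = A - G"
  define E where "E = G - A"
  have DE: "finite D" "finite E" "D \<inter> E = {}" "card D = card E" "card E \<le> N" "E \<inter> A = {}"
    "A \<union> G = D \<union> G" "A \<union> G = E \<union> A"
  proof -
    show "finite D" "finite E" "D \<inter> E = {}" "E \<inter> A = {}" "A \<union> G = D \<union> G" "A \<union> G = E \<union> A"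
      using A(1) G(1) by (auto simp: D_def E_def)
    show "card D = card E" unfolding D_def E_def
      using A G(1,2) by (metis antisym card_le_sym_Diff order_refl)
    show "card E \<le> N" unfolding E_def using G(1,2) card_mono[of G "G - A"] by auto
  qed
  have xG: "x - P G x = P D x + u"
  proof -
    have "D \<inter> G = {}" by (auto simp: D_def)
    then show ?thesis unfolding u_def DE(7) by (simp add: coord_proj_Un[OF DE(1) G(1)])
  qed
  have "norm (x - P G x) \<le> ?d * norm y"
  \<comment> \<open>Without a part on \<open>D\<close> the remainder is just \<open>u\<close>.
    Otherwise a nonzero coefficient on \<open>D\<close> makes \<open>D\<close> and \<open>E\<close>
    nonempty and \<open>t\<close> positive.\<close>
  proof (cases "P D x = 0")
    case True
    then show ?thesis using xG u_le d1 mult_right_mono[OF d1, of "norm y"] by simp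
  next
    case False
    then have "\<exists>n\<in>D. f n x \<noteq> 0" using coord_proj_zero by blast
    then obtain n0 where n0: "n0 \<in> D" "f n0 x \<noteq> 0" by blast
    have ne: "D \<noteq> {}" "E \<noteq> {}" using n0 DE by auto
    define t where "t = Min ((\<lambda>n. norm (f n x)) ` E)"
    have t_le: "t \<le> norm (f n x)" if "n \<in> E" for n
      using that DE(2) by (simp add: t_def)
    have "t \<in> (\<lambda>n. norm (f n x)) ` E" unfolding t_def using DE(2) ne by (intro Min_in) auto
    then have t_ge: "norm (f n x) \<le> t" if "n \<notin> G" for n
      using that G(3) by (auto simp: E_def)
    have t: "t > 0" using t_ge[of n0] n0 by (simp add: D_def) (meson less_le_trans zero_less_norm_iff)
    have fE: "f n x \<noteq> 0" if "n \<in> E" for n using t_le[OF that] t by auto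
    \<comment> \<open>The default 1 keeps the sequence unimodular, as \<open>sgn 0\<close> is 0; on
      \<open>E\<close> the coefficients are nonzero and \<open>\<eta>\<close> is their
      phase.\<close>
    define \<eta> where "\<eta> n = (if f n x = 0 then 1 else sgn (f n x))" for n
    have \<eta>: "\<eta> \<in> sign_seqs" by (simp add: sign_seqs_def \<eta>_def norm_sgn)
    \<comment> \<open>Coefficients off \<open>G\<close> have modulus at most \<open>t\<close>, so
      this rescaling meets the normalization in the definition of \<nu>.\<close>
    define v where "v = (1 / t) *\<^sub>R u"
    have v: "u = t *\<^sub>R v" using t by (simp add: v_def)
    have fv: "norm (f n v) \<le> 1" "n \<in> D \<union> E \<Longrightarrow> f n v = 0" for n
      using t t_ge[of n] by (auto simp: v_def coord_scaleR fu D_def E_def norm_mult norm_divide divide_le_eq)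
    define w where "w = y - P A y"
    have w_le: "norm w \<le> norm y"
      unfolding w_def using norm_coord_proj_compl_le[OF k A(1)] .
    have fw: "f n w = f n x" if "n \<in> E" for n
      using that DE(6) fy A(1) by (auto simp: w_def coord_simps coord_coord_proj)
    have w: "w = P E x + u"
    proof -
      have "P E y = P E x" using fy by (intro coord_proj_eq) (auto simp: E_def)
      then show ?thesis
        unfolding w_def uy DE(8) using coord_proj_Un[OF DE(2) A(1) DE(6), of y] by simp
    qed
    have "norm (P D x + u) \<le> ?d * norm (t *\<^sub>R signed_indicator sc e \<eta> E + u)"
      unfolding coord_proj_def[of _ _ _ D]
    proof (rule norm_sum_le_corners[OF DE(1) t])
      show "norm (f n x) \<le> t" if "n \<in> D" for n using t_ge that by (simp add: D_def)
      fix \<epsilon> :: "nat \<Rightarrow> 'k" assume \<epsilon>: "\<epsilon> \<in> sign_seqs"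
      have "norm (signed_indicator sc e \<epsilon> D + v) \<le> ?d * norm (signed_indicator sc e \<eta> E + v)"
        using DE ne \<epsilon> \<eta> fv by (intro democracy_const_upper[OF k]) (auto simp: coeff_supp_def)
      then have "t * norm (signed_indicator sc e \<epsilon> D + v) \<le> t * (?d * norm (signed_indicator sc e \<eta> E + v))"
        using t by simp
      moreover have "t *\<^sub>R z + u = t *\<^sub>R (z + v)" for z by (simp add: v scaleR_right_distrib)
      ultimately show "norm (t *\<^sub>R signed_indicator sc e \<epsilon> D + u)
          \<le> ?d * norm (t *\<^sub>R signed_indicator sc e \<eta> E + u)"
        using t by (simp add: mult_ac)
    qed
    \<comment> \<open>The factor removed from each coefficient on \<open>E\<close> lies between 0
      and 1 and leaves modulus \<open>t\<close> with the phase intact.\<close>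
    also have "t *\<^sub>R signed_indicator sc e \<eta> E + u =
        w - (\<Sum>n\<in>E. (1 - t / norm (f n x)) *\<^sub>R sc (f n w) (e n))"
    proof -
      have "t *\<^sub>R sc (\<eta> n) (e n) = sc (f n x) (e n) - (1 - t / norm (f n x)) *\<^sub>R sc (f n w) (e n)"
        if "n \<in> E" for n
      proof -
        have "\<eta> n = of_real (1 / norm (f n x)) * f n x"
          using fE[OF that] by (simp add: \<eta>_def sgn_div_norm scaleR_conv_of_real divide_inverse)
        then have "t *\<^sub>R sc (\<eta> n) (e n) = (t / norm (f n x)) *\<^sub>R sc (f n x) (e n)"
          by (simp only: sc_of_real_mult) simp
        then show ?thesis using fw[OF that] by (simp add: algebra_simps)
      qed
      then have "t *\<^sub>R signed_indicator sc e \<eta> E =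
          (\<Sum>n\<in>E. sc (f n x) (e n) - (1 - t / norm (f n x)) *\<^sub>R sc (f n w) (e n))"
        unfolding signed_indicator_def scaleR_sum_right by (intro sum.cong) auto
      then show ?thesis by (simp add: sum_subtractf w coord_proj_def)
    qed
    also have "norm \<dots> \<le> norm w"
      using t t_le fE by (intro norm_truncate_le[OF k DE(2)]) auto
    also have "\<dots> \<le> norm y" by (rule w_le)
    finally show ?thesis using xG d1 by (simp add: mult_left_mono)
  qed
  then show ?thesis by (simp add: y_def)
qed

section \<open>Lower bound for admissible constants\<close>

lemma democracy_quotients_nonempty:
  assumes "N \<ge> 1"
  shows "democracy_quotients N \<noteq> {}"
proof -
  have "(\<lambda>_. 1) \<in> (sign_seqs :: (nat \<Rightarrow> 'k) set)" by (simp add: sign_seqs_def)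
  moreover have "coeff_sup f 0 \<le> 1" by (simp add: coeff_sup_le_iff coord_simps)
  moreover have "coeff_supp f 0 = {}" by (simp add: coeff_supp_def coord_simps)
  ultimately have "norm (signed_indicator sc e (\<lambda>_. 1) {0::nat} + 0) /
      norm (signed_indicator sc e (\<lambda>_. 1) {1::nat} + 0) \<in> democracy_quotients N"
    unfolding democracy_quotients_def using assms
    by (intro CollectI exI[of _ "{0}"] exI[of _ "{1}"] exI[of _ "\<lambda>_. 1"] exI[of _ 0]) simp
  then show ?thesis by blast
qed

text \<open>Keeping \<open>err\<close> abstract treats both approximation errors at once: being
  nonnegative and below every projection error of size at most \<open>N\<close> suffices.\<close>

lemma democracy_const_le:
  fixes err :: "'a \<Rightarrow> real"
  assumes k: "compl_proj_const sc e f N = 1" "N \<ge> 1"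
    and err: "\<And>x. 0 \<le> err x"
      "\<And>x A. finite A \<Longrightarrow> card A \<le> N \<Longrightarrow> err x \<le> norm (x - P A x)"
    and C: "\<And>x G. G \<in> greedy_maps sc e f N \<Longrightarrow> norm (x - G x) \<le> C * err x"
  shows "democracy_const sc e f N \<le> C"
proof -
  obtain K where K: "K > 0" "\<And>n. norm (e n) \<le> K" "\<And>n x. norm (f n x) \<le> K * norm x"
    using uniform_bound by blast
  have "norm (signed_indicator sc e \<epsilon> A + x) \<le> C * norm (signed_indicator sc e \<eta> B + x)"
    if AB: "finite A" "finite B" "A \<noteq> {}" "B \<noteq> {}" "card A = card B" "card B \<le> N"
      and \<epsilon>: "\<epsilon> \<in> sign_seqs" and \<eta>: "\<eta> \<in> sign_seqs" and x: "coeff_sup f x \<le> 1"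
      and disj: "A \<inter> B = {}" "A \<inter> coeff_supp f x = {}" "B \<inter> coeff_supp f x = {}"
    for A B \<epsilon> \<eta> x
  proof (rule field_le_epsilon)
    fix r :: real assume r: "r > 0"
    \<comment> \<open>With coefficients below \<open>d\<close> on at most \<open>N\<close> indices,
      the part of \<open>x\<close> on \<open>T\<close> has norm at most
      \<open>N * (d * K) = r\<close>.\<close>
    define d where "d = r / (N * K)"
    have d: "d > 0" using r K(1) k(2) by (simp add: d_def)
    let ?a = "signed_indicator sc e \<epsilon> A" and ?b = "signed_indicator sc e \<eta> B"
    txt \<open>\<open>T\<close> pads the greedy set \<open>B\<close> to cardinality \<open>N\<close>; the coefficients of \<open>x\<close> on it are negligible.\<close>
    have "infinite (- (A \<union> B \<union> {n. norm (f n x) \<ge> d}))"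
      using AB finite_large_coords[OF d] by (subst finite_compl) (auto simp: infinite_UNIV_nat)
    then obtain T where T: "finite T" "card T = N - card B"
      "T \<subseteq> - (A \<union> B \<union> {n. norm (f n x) \<ge> d})"
      using infinite_arbitrarily_large by blast
    have TAB: "A \<inter> T = {}" "B \<inter> T = {}" using T(3) by auto
    let ?c = "signed_indicator sc e (\<lambda>_. 1) T"
    \<comment> \<open>Clearing \<open>x\<close> on \<open>T\<close> makes room for an indicator with
      coefficients exactly 1 there.\<close>
    define x' where "x' = x - P T x"
    have fx': "f n x' = (if n \<in> T then 0 else f n x)" for n
      using T(1) by (simp add: x'_def coord_simps coord_coord_proj)
    have fx0: "f n x = 0" if "n \<in> A \<union> B" for n using that disj by (auto simp: coeff_supp_def)
    define y where "y = ?a + ?b + x' + ?c"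
    have fy: "f n y = (if n \<in> A then \<epsilon> n else if n \<in> B then \<eta> n else if n \<in> T then 1 else f n x)" for n
      using AB T(1) disj TAB fx0[of n]
      by (auto simp: y_def coord_simps coord_signed_indicator fx')
    \<comment> \<open>Stated symmetrically, since it serves once with \<open>B\<close> as the
      projected set and once with \<open>A\<close>.\<close>
    have proj: "P (S \<union> T) y = signed_indicator sc e \<theta> S + ?c"
      if "S \<union> R = A \<union> B" "S \<inter> R = {}" "y = signed_indicator sc e \<theta> S + signed_indicator sc e \<theta>' R + x' + ?c"
      for S R \<theta> \<theta>'
    proof -
      have fin: "finite S" "finite R" using that(1) AB by (metis finite_Un)+
      have "P (S \<union> T) (signed_indicator sc e \<theta>' R) = 0"
        using fin that(1,2) TAB by (intro coord_proj_zero) (auto simp: coord_signed_indicator)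
      moreover have "P (S \<union> T) x' = 0"
        using fx0 that(1) by (intro coord_proj_zero) (auto simp: fx')
      ultimately show ?thesis using fin T(1)
        unfolding that(3) by (simp add: coord_proj_add coord_proj_signed_indicator)
    qed
    have PB: "y - P (B \<union> T) y = ?a + x'"
      using proj[of B A \<eta> \<epsilon>] disj by (simp add: y_def Un_commute Int_commute add_ac)
    have PA: "y - P (A \<union> T) y = ?b + x'"
      using proj[of A B \<epsilon> \<eta>] disj by (simp add: y_def add_ac)
    have card: "card (B \<union> T) = N" "card (A \<union> T) = N"
      using AB T TAB by (simp_all add: card_Un_disjoint)
    \<comment> \<open>All coefficients of \<open>y\<close> on \<open>A\<close>, \<open>B\<close> and
      \<open>T\<close> have modulus 1 and the others at most 1.\<close>
    have "B \<union> T \<in> greedy_sets f y N"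
      unfolding greedy_sets_def
      using AB T(1) card(1) \<epsilon> \<eta> x disj TAB
      by (auto simp: fy sign_seqs_def coeff_sup_le_iff)
    then obtain G where G: "G \<in> greedy_maps sc e f N" "G y = P (B \<union> T) y"
      by (rule greedy_map_exists)
    have C1: "norm (?a + x') \<le> C * err y" using C[OF G(1), of y] G(2) PB by simp
    have "A \<inter> coeff_supp f x' = {}" using fx0 by (auto simp: coeff_supp_def fx')
    \<comment> \<open>A nonzero remainder forces \<open>C > 0\<close>, which allows the bound on
      \<open>err y\<close> to be multiplied by \<open>C\<close>.\<close>
    then have "?a + x' \<noteq> 0" using signed_indicator_add_nonzero AB(1,3) \<epsilon> by blast
    then have "C * err y > 0" using C1 by (meson less_le_trans zero_less_norm_iff)
    then have "C > 0" using err(1)[of y] by (simp add: zero_less_mult_iff)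
    moreover have "err y \<le> norm (?b + x)"
    proof -
      have "P T ?b = 0"
        using AB(2) TAB by (intro coord_proj_zero) (auto simp: coord_signed_indicator)
      then have "?b + x' = (?b + x) - P T (?b + x)" by (simp add: x'_def coord_proj_add)
      then have "norm (?b + x') \<le> norm (?b + x)"
        using norm_coord_proj_compl_le[OF k T(1)] by metis
      moreover have "err y \<le> norm (?b + x')"
        using err(2)[of "A \<union> T" y] AB(1) T(1) card(2) PA by simp
      ultimately show ?thesis by simp
    qed
    ultimately have "C * err y \<le> C * norm (?b + x)" by simp
    moreover have "norm (P T x) \<le> r"
    proof -
      have "norm (P T x) \<le> card T * (d * K)"
        using K(2) T(3) d by (intro norm_coord_proj_le) (auto simp: not_le dest!: subsetD intro: less_imp_le)
      also have "\<dots> \<le> N * (d * K)" using T(2) d K(1) by (intro mult_right_mono) auto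
      also have "\<dots> = r" using K(1) k(2) by (simp add: d_def)
      finally show ?thesis .
    qed
    moreover have "norm (?a + x) \<le> norm (?a + x') + norm (P T x)"
      using norm_triangle_ineq[of "?a + x'" "P T x"] by (simp add: x'_def)
    ultimately show "norm (?a + x) \<le> C * norm (?b + x) + r" using C1 by linarith
  qed
  then have "norm (signed_indicator sc e \<epsilon> A + x) / norm (signed_indicator sc e \<eta> B + x) \<le> C"
    if "finite A" "finite B" "A \<noteq> {}" "B \<noteq> {}" "card A = card B" "card B \<le> N"
      "\<epsilon> \<in> sign_seqs" "\<eta> \<in> sign_seqs" "coeff_sup f x \<le> 1"
      "A \<inter> B = {}" "A \<inter> coeff_supp f x = {}" "B \<inter> coeff_supp f x = {}"
    for A B \<epsilon> \<eta> x
    using that signed_indicator_add_nonzero[OF that(2,4,8,12)] by (simp add: divide_le_eq)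
  then have "q \<le> C" if "q \<in> democracy_quotients N" for q
    using that unfolding democracy_quotients_def by blast
  then show ?thesis
    unfolding democracy_const_eq by (intro cSup_least democracy_quotients_nonempty k)
qed

section \<open>Identification of the Lebesgue constants\<close>

lemma norm_greedy_le_best_error:
  assumes k: "compl_proj_const sc e f N = 1" "N \<ge> 1"
    and G: "G \<in> greedy_sets f x N"
  shows "norm (x - P G x) \<le> democracy_const sc e f N * best_error sc e N x"
proof -
  let ?d = "democracy_const sc e f N"
  have d1: "?d \<ge> 1" using k by (rule democracy_const_ge_1)
  \<comment> \<open>Dividing by \<open>?d\<close> gives a lower bound independent of
    \<open>z\<close>, which passes to the infimum.\<close>
  have "norm (x - P G x) / ?d \<le> dist x z" if "z \<in> sparse_vectors sc e N" for z
  proof -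
    obtain A a where A: "finite A" "card A \<le> N" "z = (\<Sum>n\<in>A. sc (a n) (e n))"
      using \<open>z \<in> sparse_vectors sc e N\<close> by (auto simp: sparse_vectors_def)
    have "infinite (- A)" using A(1) by (simp add: finite_compl)
    then obtain T where T: "finite T" "card T = N - card A" "T \<subseteq> - A"
      using infinite_arbitrarily_large by blast
    \<comment> \<open>Zero coefficients on \<open>T\<close> pad the support to cardinality
      \<open>N\<close> without changing \<open>z\<close>.\<close>
    define b where "b n = (if n \<in> A then a n else 0)" for n
    have "z = (\<Sum>n\<in>A \<union> T. sc (b n) (e n))"
      unfolding A(3) using A(1) T(1) by (intro sum.mono_neutral_cong_left) (auto simp: b_def)
    moreover have "card (A \<union> T) = N" using A T by (subst card_Un_disjoint) auto
    ultimately have "norm (x - P G x) \<le> ?d * norm (x - z)"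
      using norm_greedy_le[OF k G, of "A \<union> T" b] A(1) T(1) by simp
    then show ?thesis using d1 by (simp add: dist_norm divide_le_eq mult.commute)
  qed
  moreover have ne: "sparse_vectors sc e N \<noteq> {}" by (force simp: sparse_vectors_def)
  ultimately have "norm (x - P G x) / ?d \<le> best_error sc e N x"
    unfolding best_error_def infdist_notempty[OF ne] by (intro cINF_greatest)
  then show ?thesis using d1 by (simp add: divide_le_eq mult.commute)
qed

lemma best_error_nonneg: "0 \<le> best_error sc e N x"
  by (simp add: best_error_def infdist_nonneg)

lemma best_error_le:
  assumes "finite A" "card A \<le> N"
  shows "best_error sc e N x \<le> norm (x - P A x)"
  unfolding best_error_def dist_norm[symmetric] using assms
  by (intro infdist_le) (auto simp: sparse_vectors_def coord_proj_def)

lemma proj_error_le: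
  assumes "finite A" "card A \<le> N"
  shows "proj_error sc e f N x \<le> norm (x - P A x)"
  unfolding proj_error_def using assms
  by (intro cINF_lower bdd_belowI2[of _ 0]) auto

lemma best_error_le_proj_error: "best_error sc e N x \<le> proj_error sc e f N x"
proof -
  have "{} \<in> {A :: nat set. finite A \<and> card A \<le> N}" by simp
  then show ?thesis
    unfolding proj_error_def using best_error_le by (intro cINF_greatest) blast+
qed

text \<open>The upper bound by \<open>best_error\<close> carries over to the larger
  \<open>proj_error\<close>; minimality is \<open>democracy_const_le\<close> for each error.\<close>

lemma lebesgue_consts_eq:
  assumes k: "compl_proj_const sc e f N = 1" "N \<ge> 1"
  shows "lebesgue_const sc e f N = democracy_const sc e f N"
    and "proj_lebesgue_const sc e f N = democracy_const sc e f N"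
proof -
  let ?d = "democracy_const sc e f N"
  have best: "norm (x - G x) \<le> ?d * best_error sc e N x"
    if "G \<in> greedy_maps sc e f N" for x G
  proof -
    obtain S where "S \<in> greedy_sets f x N" "G x = P S x"
      using \<open>G \<in> greedy_maps sc e f N\<close> by (auto simp: greedy_maps_def)
    then show ?thesis using norm_greedy_le_best_error[OF k] by simp
  qed
  have "?d * best_error sc e N x \<le> ?d * proj_error sc e f N x" for x
    using democracy_const_ge_1[OF k] best_error_le_proj_error by (intro mult_left_mono) auto
  then have proj: "norm (x - G x) \<le> ?d * proj_error sc e f N x"
    if "G \<in> greedy_maps sc e f N" for x G
    using best[OF that] order_trans by blast
  show "lebesgue_const sc e f N = ?d"
    unfolding lebesgue_const_def
  proof (rule Least_equality)
    show "?d \<le> C"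
      if "\<forall>x. \<forall>G\<in>greedy_maps sc e f N. norm (x - G x) \<le> C * best_error sc e N x" for C
      using that by (intro democracy_const_le[OF k best_error_nonneg best_error_le]) auto
  qed (use best in blast)
  show "proj_lebesgue_const sc e f N = ?d"
    unfolding proj_lebesgue_const_def
  proof (rule Least_equality)
    show "?d \<le> C"
      if "\<forall>x. \<forall>G\<in>greedy_maps sc e f N. norm (x - G x) \<le> C * proj_error sc e f N x" for C
      using that order_trans[OF best_error_nonneg best_error_le_proj_error]
      by (intro democracy_const_le[OF k _ proj_error_le]) auto
  qed (use proj in blast)
qed

end

theorem corollary1p6:
  "(\<forall>(e :: nat \<Rightarrow> 'a::banach) (f :: nat \<Rightarrow> 'a \<Rightarrow> real) (N :: nat).
      seminormalized_biorthogonal_system (scaleR :: real \<Rightarrow> 'a \<Rightarrow> 'a) e f \<longrightarrow>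
      N \<ge> 1 \<longrightarrow> compl_proj_const scaleR e f N = 1 \<longrightarrow>
      lebesgue_const scaleR e f N = proj_lebesgue_const scaleR e f N \<and>
      proj_lebesgue_const scaleR e f N = democracy_const scaleR e f N) \<and>
   (\<forall>(sc :: complex \<Rightarrow> 'b::banach \<Rightarrow> 'b) (e :: nat \<Rightarrow> 'b) (f :: nat \<Rightarrow> 'b \<Rightarrow> complex) (N :: nat).
      seminormalized_biorthogonal_system sc e f \<longrightarrow>
      N \<ge> 1 \<longrightarrow> compl_proj_const sc e f N = 1 \<longrightarrow>
      lebesgue_const sc e f N = proj_lebesgue_const sc e f N \<and>
      proj_lebesgue_const sc e f N = democracy_const sc e f N)"
  using seminormalized_biorthogonal_system.lebesgue_consts_eq by metis

end
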